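(* Let $(K,|\cdot|)$ be an algebraically closed non-archimedean valued field of characteristic $0$, with valuation ring $\mathcal{O}_K=\{x\in K: |x|\le 1\}$ and maximal ideal $\mathfrak{m}_K=\{x\in K:|x|<1\}$. Let $f(z)=z^n+a_{n-1}z^{n-1}+\cdots+a_1z+a_0\in K[z]$ be monic of degree $n\ge 2$ such that all zeros of $f$ lie in the closed unit disk $\{x\in K:|x|\le 1\}$ (equivalently $a_i\in\mathcal{O}_K$ for all $i$). Define $$I(f)=\max_{z:\,f(z)=0}\ \min_{w:\,f'(w)=0}|z-w|.$$ Assume $|n|=1$. Then $I(f)=1$ if and only if $\overline{f}$ does not divide $\overline{f'}^{\,n}$ in $(\mathcal{O}_K/\mathfrak{m}_K)[z]$, where the bar denotes coefficientwise reduction modulo $\mathfrak{m}_K$.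
   Context: A non-archimedean field is a field with an absolute value satisfying $|x+y|\le\max\{|x|,|y|\}$; the integer $n$ is viewed as an element of $K$. Here $1=|n|^{-1/(n-1)}$ is the optimal upper bound for $I(f)$. *)

theory Defs
  imports
    "HOL-Computational_Algebra.Polynomial"
    "HOL-Algebra.UnivPoly"
    "HOL-Algebra.QuotRing"
    "HOL-Algebra.Divisibility"
begin

text \<open>The trivial absolute value is allowed.\<close>

locale nonarch_absolute_value =
  fixes v :: "'a::field \<Rightarrow> real"
  assumes v_nonneg: "0 \<le> v x"
    and v_eq_0_iff: "v x = 0 \<longleftrightarrow> x = 0"
    and v_mult: "v (x * y) = v x * v y"
    and v_add_le_max: "v (x + y) \<le> max (v x) (v y)"

definition valuation_ring :: "('a::field \<Rightarrow> real) \<Rightarrow> 'a ring" where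
  "valuation_ring v = \<lparr>carrier = {x. v x \<le> 1}, mult = (*), one = 1, zero = 0, add = (+)\<rparr>"

definition valuation_ideal :: "('a::field \<Rightarrow> real) \<Rightarrow> 'a set" where
  "valuation_ideal v = {x. v x < 1}"

definition residue_field :: "('a::field \<Rightarrow> real) \<Rightarrow> 'a set ring" where
  "residue_field v = valuation_ring v Quot valuation_ideal v"

text \<open>
  Elements of the HOL-Algebra polynomial ring \<^const>\<open>UP\<close> are coefficient sequences, so
  reducing each coefficient to its coset directly gives such an element.  This is meaningful
  only for polynomials all of whose coefficients lie in the valuation ring.
\<close>

definition reduction :: "('a::field \<Rightarrow> real) \<Rightarrow> 'a poly \<Rightarrow> nat \<Rightarrow> 'a set" where
  "reduction v f = (\<lambda>i. valuation_ideal v +>\<^bsub>valuation_ring v\<^esub> poly.coeff f i)"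

text \<open>
  \<^const>\<open>Max\<close> and \<^const>\<open>Min\<close> are meaningful only for finite nonempty sets, hence only when both
  the polynomial and its derivative are nonzero and have a zero; over an algebraically closed
  field of characteristic 0 this holds for every polynomial of degree at least 2.
\<close>

definition critical_distance :: "('a::field \<Rightarrow> real) \<Rightarrow> 'a poly \<Rightarrow> real" where
  "critical_distance v f =
    Max ((\<lambda>z. Min ((\<lambda>w. v (z - w)) ` {w. poly (pderiv f) w = 0})) ` {z. poly f z = 0})"

context nonarch_absolute_value
begin

lemma v_1: "v 1 = 1"
  by (metis v_mult v_eq_0_iff mult_cancel_left1 mult_1_left zero_neq_one)

lemma v_uminus: "v (- x) = v x"
proof -
  have "v (-1) * v (-1) = 1" using v_mult[of "-1" "-1"] v_1 by simp
  hence "v (-1) = 1" using v_nonneg[of "-1"] by (metis abs_of_nonneg power2_eq_square real_sqrt_abs real_sqrt_one)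
  thus ?thesis using v_mult[of "-1" x] by simp
qed

lemma valuation_ring_cring: "cring (valuation_ring v)"
proof (rule cringI)
  show "abelian_group (valuation_ring v)"
  proof (rule abelian_groupI)
    fix x y assume "x \<in> carrier (valuation_ring v)" "y \<in> carrier (valuation_ring v)"
    thus "x \<oplus>\<^bsub>valuation_ring v\<^esub> y \<in> carrier (valuation_ring v)"
      using v_add_le_max[of x y] by (simp add: valuation_ring_def)
  next
    fix x assume "x \<in> carrier (valuation_ring v)"
    thus "\<exists>y\<in>carrier (valuation_ring v). y \<oplus>\<^bsub>valuation_ring v\<^esub> x = \<zero>\<^bsub>valuation_ring v\<^esub>"
      using v_uminus[of x] by (intro bexI[of _ "-x"]) (simp_all add: valuation_ring_def)
  qed (use v_eq_0_iff[of 0] in \<open>simp_all add: valuation_ring_def ac_simps\<close>)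
  show "comm_monoid (valuation_ring v)"
    by (rule comm_monoidI)
      (auto simp: valuation_ring_def v_1 v_mult ac_simps intro!: mult_le_one v_nonneg)
qed (simp add: valuation_ring_def algebra_simps)

lemma valuation_ideal_maximal: "maximalideal (valuation_ideal v) (valuation_ring v)"
proof -
  interpret R: cring "valuation_ring v" by (rule valuation_ring_cring)
  have minus: "\<ominus>\<^bsub>valuation_ring v\<^esub> x = - x" if "v x \<le> 1" for x
    by (rule R.minus_equality) (use that v_uminus[of x] in \<open>simp_all add: valuation_ring_def\<close>)
  have small: "v (a * b) < 1" if "v a < 1" "v b \<le> 1" for a b
    using that v_nonneg[of a] v_nonneg[of b] mult_left_le[of "v b" "v a"] by (simp add: v_mult)
  interpret I: ideal "valuation_ideal v" "valuation_ring v"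
  proof (rule idealI)
    show "ring (valuation_ring v)" by (rule R.ring_axioms)
    show "subgroup (valuation_ideal v) (add_monoid (valuation_ring v))"
    proof (rule R.add.subgroupI)
      show "valuation_ideal v \<subseteq> carrier (valuation_ring v)"
        by (auto simp: valuation_ideal_def valuation_ring_def)
      show "valuation_ideal v \<noteq> {}"
        using v_eq_0_iff[of 0] by (auto simp: valuation_ideal_def intro!: exI[of _ 0])
    next
      fix a assume "a \<in> valuation_ideal v"
      thus "\<ominus>\<^bsub>valuation_ring v\<^esub> a \<in> valuation_ideal v"
        using minus[of a] v_uminus[of a] by (simp add: valuation_ideal_def)
    next
      fix a b assume "a \<in> valuation_ideal v" "b \<in> valuation_ideal v"
      thus "a \<oplus>\<^bsub>valuation_ring v\<^esub> b \<in> valuation_ideal v"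
        using v_add_le_max[of a b] by (simp add: valuation_ideal_def valuation_ring_def)
    qed
  qed (use small in \<open>auto simp: valuation_ideal_def valuation_ring_def mult.commute\<close>)
  show ?thesis
  proof (rule maximalidealI[OF I.ideal_axioms])
    show "carrier (valuation_ring v) \<noteq> valuation_ideal v"
    proof -
      have "1 \<in> carrier (valuation_ring v)" "1 \<notin> valuation_ideal v"
        using v_1 by (simp_all add: valuation_ring_def valuation_ideal_def)
      thus ?thesis by metis
    qed
  next
    fix J assume J: "ideal J (valuation_ring v)" "valuation_ideal v \<subseteq> J" "J \<subseteq> carrier (valuation_ring v)"
    show "J = valuation_ideal v \<or> J = carrier (valuation_ring v)"
    proof (cases "J \<subseteq> valuation_ideal v")
      case False
      then obtain x where x: "x \<in> J" "v x = 1"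
        using J(3) by (force simp: valuation_ring_def valuation_ideal_def)
      hence nz: "x \<noteq> 0" using v_eq_0_iff[of 0] by auto
      have inv: "v (inverse x) = 1" using v_mult[of x "inverse x"] x nz v_1 by simp
      have "inverse x \<otimes>\<^bsub>valuation_ring v\<^esub> x \<in> J"
        by (rule ideal.I_l_closed[OF J(1) x(1)]) (use inv in \<open>simp add: valuation_ring_def\<close>)
      hence "\<one>\<^bsub>valuation_ring v\<^esub> \<in> J" using nz by (simp add: valuation_ring_def)
      thus ?thesis using ideal.one_imp_carrier[OF J(1)] by simp
    qed (use J in auto)
  qed
qed

lemma residue_field_field: "field (residue_field v)"
  unfolding residue_field_def
  using maximalideal.quotient_is_field[OF valuation_ideal_maximal valuation_ring_cring] .

lemma reduction_closed:
  assumes "\<And>i. v (poly.coeff f i) \<le> 1"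
  shows "reduction v f \<in> carrier (UP (residue_field v))"
proof -
  interpret R: cring "valuation_ring v" by (rule valuation_ring_cring)
  interpret I: maximalideal "valuation_ideal v" "valuation_ring v" by (rule valuation_ideal_maximal)
  have "reduction v f i \<in> carrier (residue_field v)" for i
    using assms[of i] unfolding reduction_def residue_field_def FactRing_def A_RCOSETS_def'
    by (auto simp: valuation_ring_def)
  moreover have "bound \<zero>\<^bsub>residue_field v\<^esub> (Polynomial.degree f) (reduction v f)"
  proof
    fix i assume "Polynomial.degree f < i"
    hence "poly.coeff f i = \<zero>\<^bsub>valuation_ring v\<^esub>" by (simp add: valuation_ring_def coeff_eq_0)
    moreover have "valuation_ideal v +>\<^bsub>valuation_ring v\<^esub> \<zero>\<^bsub>valuation_ring v\<^esub> = valuation_ideal v"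
      by (rule R.a_coset_add_zero) (auto simp: valuation_ideal_def valuation_ring_def)
    ultimately show "reduction v f i = \<zero>\<^bsub>residue_field v\<^esub>"
      by (simp add: reduction_def residue_field_def FactRing_def)
  qed
  ultimately show ?thesis by (auto simp: UP_def)
qed

end

end

theory Submission
  imports Defs
begin

text \<open>
  Write $f' = n \prod_j (X - w_j)$.  As $|n| = 1$ and all $|z - w_j| \le 1$ for a zero $z$ of $f$,
  one has $I(f) = 1$ iff $|f'(z)| = 1$ for some zero $z$ of $f$.  If $\bar f$ divides
  $\bar f'^n$, evaluating at $z$ gives $|f'(z)| < 1$ for every zero $z$.  Conversely, if
  $|f'(z_i)| < 1$ for all zeros $z_1, \dots, z_n$, then dividing $f'$ by $X - z_i$ shows that
  $X - \bar z_i$ divides $\bar f'$, and the product of these $n$ linear factors is $\bar f$.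
\<close>

context nonarch_absolute_value
begin

section \<open>Ultrametric estimates and polynomials over the valuation ring\<close>

definition integral_poly :: "'a poly \<Rightarrow> bool" where
  "integral_poly p \<longleftrightarrow> (\<forall>i. v (poly.coeff p i) \<le> 1)"

lemma v_0 [simp]: "v 0 = 0"
  by (simp add: v_eq_0_iff)

lemma v_diff_le_max: "v (x - y) \<le> max (v x) (v y)"
  using v_add_le_max[of x "- y"] by (simp add: v_uminus)

lemma v_power: "v (x ^ k) = v x ^ k"
  by (induction k) (simp_all add: v_1 v_mult)

lemma v_prod_mset: "v (prod_mset A) = prod_mset (image_mset v A)"
  by (induction A) (simp_all add: v_1 v_mult)

lemma v_mult_le_1: "v x \<le> 1 \<Longrightarrow> v y \<le> 1 \<Longrightarrow> v (x * y) \<le> 1"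
  by (simp add: v_mult mult_le_one v_nonneg)

lemma v_add_le_1: "v x \<le> 1 \<Longrightarrow> v y \<le> 1 \<Longrightarrow> v (x + y) \<le> 1"
  using v_add_le_max[of x y] by simp

lemma v_mult_less_1: "v x < 1 \<Longrightarrow> v y \<le> 1 \<Longrightarrow> v (x * y) < 1"
  using mult_left_le[of "v y" "v x"] v_nonneg[of x] by (simp add: v_mult)

lemma v_add_less_1: "v x < 1 \<Longrightarrow> v y < 1 \<Longrightarrow> v (x + y) < 1"
  using v_add_le_max[of x y] by simp

lemma v_sum_le_1: "(\<And>i. i \<in> A \<Longrightarrow> v (g i) \<le> 1) \<Longrightarrow> v (sum g A) \<le> 1"
  by (induction A rule: infinite_finite_induct) (simp_all add: v_add_le_1)

text \<open>The ultrametric inequality preserves strict bounds under finite sums. Positivity of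
  \<open>r\<close> covers the sums that are 0 by convention, over an empty or infinite index
  set.\<close>

lemma v_sum_less:
  "0 < r \<Longrightarrow> (\<And>i. i \<in> A \<Longrightarrow> v (g i) < r) \<Longrightarrow> v (sum g A) < r"
proof (induction A rule: infinite_finite_induct)
  case (insert a A)
  then show ?case using v_add_le_max[of "g a" "sum g A"] by force
qed simp_all

text \<open>A natural number is a sum of ones, each of value 1. This is what makes differentiation
  preserve integrality.\<close>

lemma v_of_nat_le_1: "v (of_nat k) \<le> 1"
  by (induction k) (simp_all add: v_add_le_1 v_1)

lemma integral_poly_pCons [simp]:
  "integral_poly (pCons a p) \<longleftrightarrow> v a \<le> 1 \<and> integral_poly p"
  by (auto simp: integral_poly_def coeff_pCons split: nat.split)

lemma integral_poly_0 [simp]: "integral_poly 0"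
  by (simp add: integral_poly_def)

lemma integral_poly_1 [simp]: "integral_poly 1"
  by (simp add: one_pCons v_1)

lemma integral_poly_mult: "integral_poly p \<Longrightarrow> integral_poly q \<Longrightarrow> integral_poly (p * q)"
  by (auto simp: integral_poly_def coeff_mult intro!: v_sum_le_1 v_mult_le_1)

lemma integral_poly_power: "integral_poly p \<Longrightarrow> integral_poly (p ^ k)"
  by (induction k) (simp_all add: integral_poly_mult)

lemma integral_poly_prod_mset:
  "(\<And>x. x \<in># A \<Longrightarrow> integral_poly (g x)) \<Longrightarrow> integral_poly (\<Prod>x\<in>#A. g x)"
  by (induction A) (auto intro: integral_poly_mult)

lemma integral_poly_pderiv: "integral_poly p \<Longrightarrow> integral_poly (pderiv p)"
  unfolding integral_poly_def coeff_pderiv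
  by (metis v_mult_le_1 v_of_nat_le_1)

lemma v_poly_le_1: "integral_poly p \<Longrightarrow> v z \<le> 1 \<Longrightarrow> v (poly p z) \<le> 1"
  by (induction p) (simp_all add: v_add_le_1 v_mult_le_1)

text \<open>Used on differences of polynomials with equal reduction: evaluation at a point of the
  unit disk respects congruence modulo the maximal ideal.\<close>

lemma v_poly_less_1:
  "(\<And>i. v (poly.coeff p i) < 1) \<Longrightarrow> v z \<le> 1 \<Longrightarrow> v (poly p z) < 1"
proof (induction p)
  case (pCons a p)
  have "v a < 1" using pCons.prems(1)[of 0] by simp
  moreover have "v (poly p z) < 1"
    using pCons.prems(1)[of "Suc _"] by (intro pCons.IH pCons.prems) simp
  ultimately show ?case
    using pCons.prems(2) v_mult_less_1[of "poly p z" z] by (simp add: v_add_less_1 mult.commute)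
qed simp

text \<open>By the Horner scheme, the coefficients of the quotient are values at \<open>z\<close> of
  the tails of \<open>p\<close>, hence integral.\<close>

lemma integral_poly_synthetic_div:
  "integral_poly p \<Longrightarrow> v z \<le> 1 \<Longrightarrow> integral_poly (synthetic_div p z)"
  by (induction p) (simp_all add: v_poly_le_1)

text \<open>Outside the unit disk the leading term strictly dominates all other terms, so the terms
  cannot cancel.\<close>

lemma v_root_le_1:
  assumes p: "integral_poly p" and lead: "v (lead_coeff p) = 1" and root: "poly p w = 0"
  shows "v w \<le> 1"
proof (rule ccontr)
  assume "\<not> v w \<le> 1"
  then have w: "1 < v w" by simp
  define d where "d = degree p"
  have "v (\<Sum>i<d. poly.coeff p i * w ^ i) < v w ^ d"
  proof (rule v_sum_less)
    show "0 < v w ^ d" using w by simp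
    fix i assume i: "i \<in> {..<d}"
    have "v (poly.coeff p i * w ^ i) \<le> v w ^ i"
      using p w by (simp add: v_mult v_power integral_poly_def mult_left_le_one_le v_nonneg)
    also have "\<dots> < v w ^ d" using w i by (simp add: power_strict_increasing)
    finally show "v (poly.coeff p i * w ^ i) < v w ^ d" .
  qed
  \<comment> \<open>The root equation solved for the leading term, whose value is exactly
    \<open>v w ^ d\<close>; this contradicts the strict bound just obtained.\<close>
  moreover have "(\<Sum>i<d. poly.coeff p i * w ^ i) = - (lead_coeff p * w ^ d)"
    using root unfolding poly_altdef d_def[symmetric]
    by (simp add: lessThan_Suc_atMost[symmetric] eq_neg_iff_add_eq_0)
  ultimately show False using lead by (simp add: v_uminus v_mult v_power)
qed

section \<open>Coefficientwise reduction to the residue field\<close>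

lemma finsum_valuation_ring:
  fixes m :: nat
  assumes "\<And>i. v (g i) \<le> 1"
  shows "finsum (valuation_ring v) g {..m} = sum g {..m}"
proof -
  interpret R: cring "valuation_ring v" by (rule valuation_ring_cring)
  have g: "g i \<in> carrier (valuation_ring v)" for i
    using assms by (simp add: valuation_ring_def)
  show ?thesis
  proof (induction m)
    case 0
    then show ?case using g R.finsum_insert[of "{}" 0 g] R.r_zero by simp
  next
    case (Suc m)
    then show ?case
      using R.finsum_Suc[of g m] g by (simp add: valuation_ring_def add.commute)
  qed
qed

lemma residue_ring_hom_cring:
  "ring_hom_cring (valuation_ring v) (residue_field v)
    (\<lambda>x. valuation_ideal v +>\<^bsub>valuation_ring v\<^esub> x)"
proof -
  interpret I: maximalideal "valuation_ideal v" "valuation_ring v" by (rule valuation_ideal_maximal)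
  show ?thesis
    unfolding residue_field_def by (rule I.rcos_ring_hom_cring[OF valuation_ring_cring])
qed

lemma residue_eq_iff:
  assumes "v x \<le> 1" "v y \<le> 1"
  shows "valuation_ideal v +>\<^bsub>valuation_ring v\<^esub> x = valuation_ideal v +>\<^bsub>valuation_ring v\<^esub> y
    \<longleftrightarrow> v (x - y) < 1"
proof -
  \<comment> \<open>The coset of \<open>a\<close> is the open unit ball around
    \<open>a\<close>.\<close>
  have coset: "valuation_ideal v +>\<^bsub>valuation_ring v\<^esub> a = {b. v (b - a) < 1}" for a
  proof -
    have "b \<in> (\<lambda>h. h + a) ` {x. v x < 1}" if "v (b - a) < 1" for b
      using that by (intro image_eqI[of _ _ "b - a"]) simp_all
    then show ?thesis
      by (auto simp: a_r_coset_def' valuation_ideal_def valuation_ring_def)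
  qed
  \<comment> \<open>In an ultrametric ball every point is a centre, so nearby \<open>x\<close> and
    \<open>y\<close> give the same ball. The converse follows because \<open>x\<close> lies in its
    own ball.\<close>
  have "v (b - x) < 1 \<longleftrightarrow> v (b - y) < 1" if "v (x - y) < 1" for b
    using v_add_less_1[of "b - x" "x - y"] v_add_less_1[of "b - y" "y - x"] that v_uminus[of "x - y"]
    by auto
  moreover have "v (x - x) < 1" by simp
  ultimately show ?thesis unfolding coset by blast
qed

text \<open>Turns equality over the residue field into coefficient estimates in the original field,
  so that later arguments can work with \<open>'a poly\<close>.\<close>

lemma reduction_eq_iff:
  assumes "integral_poly p" "integral_poly q"
  shows "reduction v p = reduction v q \<longleftrightarrow> (\<forall>i. v (poly.coeff (p - q) i) < 1)"
  using assms unfolding reduction_def fun_eq_iff integral_poly_def by (simp add: residue_eq_iff)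

lemma reduction_in_carrier:
  "integral_poly p \<Longrightarrow> reduction v p \<in> carrier (UP (residue_field v))"
  by (simp add: integral_poly_def reduction_closed)

lemma UP_cring_residue_field: "UP_cring (residue_field v)"
  using residue_field_field by (simp add: UP_cring_def fieldE(1))

text \<open>Both products have convolutions as coefficients, one with sums in the field and one with
  \<open>finsum\<close> in the residue field. The passage goes through \<open>finsum\<close> in the
  valuation ring, which the quotient homomorphism preserves.\<close>

lemma reduction_mult:
  assumes "integral_poly p" "integral_poly q"
  shows "reduction v (p * q) = reduction v p \<otimes>\<^bsub>UP (residue_field v)\<^esub> reduction v q"
proof
  fix m
  interpret h: ring_hom_cring "valuation_ring v" "residue_field v"
    "\<lambda>x. valuation_ideal v +>\<^bsub>valuation_ring v\<^esub> x"
    by (rule residue_ring_hom_cring)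
  let ?r = "\<lambda>x. valuation_ideal v +>\<^bsub>valuation_ring v\<^esub> x"
  let ?t = "\<lambda>i. poly.coeff p i * poly.coeff q (m - i)"
  have c: "poly.coeff p i \<in> carrier (valuation_ring v)"
    "poly.coeff q i \<in> carrier (valuation_ring v)" for i
    using assms by (auto simp: integral_poly_def valuation_ring_def)
  have t: "?t i = poly.coeff p i \<otimes>\<^bsub>valuation_ring v\<^esub> poly.coeff q (m - i)" for i
    by (simp add: valuation_ring_def)
  have "v (?t i) \<le> 1" for i
    using assms by (simp add: integral_poly_def v_mult_le_1)
  then have "reduction v (p * q) m = ?r (finsum (valuation_ring v) ?t {..m})"
    by (simp add: reduction_def coeff_mult finsum_valuation_ring)
  also have "\<dots> = finsum (residue_field v) (?r \<circ> ?t) {..m}"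
    unfolding t by (rule h.hom_finsum) (use c in auto)
  also have "?r \<circ> ?t = (\<lambda>i. reduction v p i \<otimes>\<^bsub>residue_field v\<^esub> reduction v q (m - i))"
    unfolding t reduction_def by (rule ext) (use c in simp)
  finally show "reduction v (p * q) m = (reduction v p \<otimes>\<^bsub>UP (residue_field v)\<^esub> reduction v q) m"
    using assms[THEN reduction_in_carrier] by (simp add: UP_def)
qed

lemma reduction_power:
  assumes "integral_poly p"
  shows "reduction v (p ^ k) = reduction v p [^]\<^bsub>UP (residue_field v)\<^esub> k"
proof (induction k)
  case 0
  interpret h: ring_hom_cring "valuation_ring v" "residue_field v"
    "\<lambda>x. valuation_ideal v +>\<^bsub>valuation_ring v\<^esub> x"
    by (rule residue_ring_hom_cring)
  \<comment> \<open>The reduction of 1 is the coset of 1 in degree 0 and the zero coset in all other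
    degrees, which is the unit of \<open>UP\<close>.\<close>
  show ?case
    using h.hom_one h.hom_zero
    by (auto simp: fun_eq_iff of_bool_def reduction_def UP_def valuation_ring_def nat_pow_def)
next
  case (Suc k)
  interpret P: UP_cring "residue_field v" "UP (residue_field v)"
    by (rule UP_cring_residue_field) simp
  show ?case
    \<comment> \<open>The power in HOL-Algebra multiplies the new factor on the right, hence
      \<open>power_Suc2\<close>.\<close>
    using assms Suc
    by (simp add: reduction_mult integral_poly_power power_Suc2 del: power_Suc)
qed

lemma reduction_surj:
  assumes "q \<in> carrier (UP (residue_field v))"
  obtains Q where "integral_poly Q" "reduction v Q = q"
proof -
  interpret h: ring_hom_cring "valuation_ring v" "residue_field v"
    "\<lambda>x. valuation_ideal v +>\<^bsub>valuation_ring v\<^esub> x"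
    by (rule residue_ring_hom_cring)
  let ?r = "\<lambda>x. valuation_ideal v +>\<^bsub>valuation_ring v\<^esub> x"
  obtain N where N: "\<And>i. N < i \<Longrightarrow> q i = \<zero>\<^bsub>residue_field v\<^esub>"
    using assms by (auto simp: UP_def up_def bound_def)
  have "\<exists>x. v x \<le> 1 \<and> ?r x = q i" for i
  proof -
    have "q i \<in> carrier (residue_field v)" using assms by (auto simp: UP_def)
    then show ?thesis
      by (auto simp: residue_field_def FactRing_def A_RCOSETS_def' valuation_ring_def)
  qed
  then obtain c where c: "\<And>i. v (c i) \<le> 1" "\<And>i. ?r (c i) = q i" by metis
  \<comment> \<open>The chosen representatives \<open>c i\<close> may be nonzero elements of the
    ideal for arbitrarily large \<open>i\<close>, so the sequence is cut off after index
    \<open>N\<close>; beyond it \<open>q\<close> is zero anyway.\<close>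
  define Q where "Q = Poly (map c [0..<Suc N])"
  have coeff: "poly.coeff Q i = (if i \<le> N then c i else 0)" for i
    by (simp add: Q_def nth_default_def del: upt_Suc)
  show ?thesis
  proof
    show "integral_poly Q" using c(1) by (simp add: integral_poly_def coeff)
    show "reduction v Q = q"
      using c(2) N h.hom_zero by (auto simp: fun_eq_iff reduction_def coeff valuation_ring_def)
  qed
qed

section \<open>Divisibility of reductions and values at the roots\<close>

lemma reduction_linear_factor:
  assumes "integral_poly p" "v z \<le> 1" "v (poly p z) < 1"
  shows "reduction v p = reduction v ([:-z, 1:] * synthetic_div p z)"
proof -
  \<comment> \<open>Division by the linear factor leaves the constant remainder
    \<open>poly p z\<close>, which vanishes in the residue field.\<close>
  have "p - [:-z, 1:] * synthetic_div p z = [:poly p z:]"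
    using synthetic_div_correct'[of z p] by (metis add_diff_cancel_left')
  moreover have "v (poly.coeff [:poly p z:] i) < 1" for i
    using assms(3) by (cases i) simp_all
  moreover have "integral_poly ([:-z, 1:] * synthetic_div p z)"
    using assms by (intro integral_poly_mult integral_poly_synthetic_div)
      (simp_all add: v_1 v_uminus)
  ultimately show ?thesis using assms(1) by (simp only: reduction_eq_iff) blast
qed

text \<open>Each of the \<open>size A\<close> copies of \<open>p\<close> supplies one linear factor.
  Repeated elements of \<open>A\<close> therefore cause no difficulty: every occurrence uses its own
  copy.\<close>

lemma reduction_power_eq_prod_mult:
  assumes p: "integral_poly p" and A: "\<And>z. z \<in># A \<Longrightarrow> v z \<le> 1 \<and> v (poly p z) < 1"
  obtains Q where "integral_poly Q"
    "reduction v (p ^ size A) = reduction v ((\<Prod>z\<in>#A. [:-z, 1:]) * Q)"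
proof -
  have "\<exists>Q. integral_poly Q \<and>
      reduction v (p ^ size A) = reduction v ((\<Prod>z\<in>#A. [:-z, 1:]) * Q)"
    using A
  proof (induction A)
    case empty
    then show ?case by (intro exI[of _ 1]) simp
  next
    case (add z A)
    then obtain Q where Q: "integral_poly Q"
      "reduction v (p ^ size A) = reduction v ((\<Prod>z\<in>#A. [:-z, 1:]) * Q)"
      by force
    define q where "q = synthetic_div p z"
    have z: "v z \<le> 1" "v (poly p z) < 1" using add.prems by auto
    have q: "integral_poly q" using p z by (simp add: q_def integral_poly_synthetic_div)
    have lin: "integral_poly ([:-z, 1:])" using z by (simp add: v_1 v_uminus)
    have prod: "integral_poly (\<Prod>z\<in>#A. [:-z, 1:])"
      using add.prems by (intro integral_poly_prod_mset) (auto simp: v_1 v_uminus)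
    have "reduction v (p ^ size (add_mset z A)) = reduction v p
        \<otimes>\<^bsub>UP (residue_field v)\<^esub> reduction v (p ^ size A)"
      using p by (simp add: reduction_mult integral_poly_power)
    also have "\<dots> = reduction v (([:-z, 1:] * q) * ((\<Prod>z\<in>#A. [:-z, 1:]) * Q))"
      unfolding Q(2) reduction_linear_factor[OF p z] q_def[symmetric]
      by (rule reduction_mult[symmetric]) (intro integral_poly_mult lin q prod Q(1))+
    also have "([:-z, 1:] * q) * ((\<Prod>z\<in>#A. [:-z, 1:]) * Q)
        = (\<Prod>z\<in>#add_mset z A. [:-z, 1:]) * (q * Q)"
      by (simp only: image_mset_add_mset prod_mset.add_mset mult_ac)
    finally show ?case using q Q(1) integral_poly_mult by blast
  qed
  then show ?thesis using that by blast
qed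

lemma reduction_divides_power_iff:
  assumes p: "integral_poly p" and A: "\<And>z. z \<in># A \<Longrightarrow> v z \<le> 1"
  shows "reduction v (\<Prod>z\<in>#A. [:-z, 1:]) divides\<^bsub>UP (residue_field v)\<^esub>
      (reduction v p [^]\<^bsub>UP (residue_field v)\<^esub> size A)
    \<longleftrightarrow> (\<forall>z\<in>#A. v (poly p z) < 1)"
proof -
  let ?f = "\<Prod>z\<in>#A. [:-z, 1:]"
  have f: "integral_poly ?f"
    using A by (intro integral_poly_prod_mset) (auto simp: v_1 v_uminus)
  show ?thesis
    unfolding reduction_power[OF p, symmetric]
  proof
    assume "reduction v ?f divides\<^bsub>UP (residue_field v)\<^esub> reduction v (p ^ size A)"
    then obtain q where q: "q \<in> carrier (UP (residue_field v))"
      "reduction v (p ^ size A) = reduction v ?f \<otimes>\<^bsub>UP (residue_field v)\<^esub> q"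
      by (auto simp: factor_def)
    \<comment> \<open>Lifting the cofactor lets the divisibility be evaluated in the original field,
      without evaluation in \<open>UP\<close>.\<close>
    obtain Q where Q: "integral_poly Q" "reduction v Q = q"
      using reduction_surj[OF q(1)] .
    have eq: "reduction v (p ^ size A) = reduction v (?f * Q)"
      using q(2) Q f by (simp add: reduction_mult)
    show "\<forall>z\<in>#A. v (poly p z) < 1"
    proof
      fix z assume z: "z \<in># A"
      have "poly ?f z = 0"
        using z by (auto simp: poly_prod_mset)
      moreover have "v (poly (p ^ size A - ?f * Q) z) < 1"
        using eq A[OF z] p f Q(1)
        by (intro v_poly_less_1) (simp_all add: reduction_eq_iff integral_poly_power integral_poly_mult)
      \<comment> \<open>The term \<open>?f * Q\<close> vanishes at \<open>z\<close>, so only the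
        power of \<open>poly p z\<close> remains in the difference.\<close>
      ultimately have "v (poly p z) ^ size A < 1"
        by (simp add: v_power)
      then show "v (poly p z) < 1"
        using one_le_power[of "v (poly p z)" "size A"] by (metis not_le)
    qed
  next
    assume "\<forall>z\<in>#A. v (poly p z) < 1"
    then obtain Q where "integral_poly Q"
      "reduction v (p ^ size A) = reduction v (?f * Q)"
      using reduction_power_eq_prod_mult[OF p, of A] A by blast
    then show "reduction v ?f divides\<^bsub>UP (residue_field v)\<^esub> reduction v (p ^ size A)"
      using f by (auto simp: factor_def reduction_mult reduction_in_carrier)
  qed
qed

end

section \<open>The critical distance and the size of the derivative at the zeros\<close>

lemma prod_mset_eq_1_imp_eq_1:
  fixes M :: "real multiset"
  assumes "\<And>x. x \<in># M \<Longrightarrow> 0 \<le> x \<and> x \<le> 1" "prod_mset M = 1" "x \<in># M"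
  shows "x = 1"
proof -
  have le: "prod_mset N \<le> 1 \<and> 0 \<le> prod_mset N" if "\<And>x. x \<in># N \<Longrightarrow> 0 \<le> x \<and> x \<le> 1"
    for N :: "real multiset"
    using that by (induction N) (auto intro: mult_le_one)
  obtain N where N: "M = add_mset x N" using assms(3) by (metis insert_DiffM)
  \<comment> \<open>The remaining factors have product at most 1, so the whole product is at most
    \<open>x\<close>; as it equals 1, so does \<open>x\<close>.\<close>
  have "x * prod_mset N \<le> x"
    using assms(1) le[of N] N by (auto intro: mult_left_le)
  then show ?thesis using assms N by force
qed

lemma one_le_prod_mset:
  fixes M :: "real multiset"
  shows "(\<And>x. x \<in># M \<Longrightarrow> 1 \<le> x) \<Longrightarrow> 1 \<le> prod_mset M"
proof (induction M)
  case (add x M)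
  then show ?case using mult_mono[of 1 x 1 "prod_mset M"] by force
qed simp

text \<open>Since the leading coefficient of the derivative has value 1,
  \<open>v (poly (pderiv f) z)\<close> is the product of the distances from \<open>z\<close> to the
  critical points, with multiplicity. All these distances are at most 1, so the product is 1 exactly
  when the smallest one is.\<close>

lemma critical_distance_eq_1_iff:
  fixes v :: "'a::{alg_closed_field, field_char_0} \<Rightarrow> real"
  assumes "nonarch_absolute_value v"
    and f: "\<And>i. v (poly.coeff f i) \<le> 1" and deg: "degree f \<ge> 2"
    and roots: "\<And>z. poly f z = 0 \<Longrightarrow> v z \<le> 1"
    and lead: "v (lead_coeff (pderiv f)) = 1"
  shows "critical_distance v f = 1 \<longleftrightarrow> (\<exists>z. poly f z = 0 \<and> v (poly (pderiv f) z) = 1)"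
proof -
  interpret nonarch_absolute_value v by fact
  let ?Z = "{z. poly f z = 0}" and ?W = "{w. poly (pderiv f) w = 0}"
  let ?d = "\<lambda>z. Min ((\<lambda>w. v (z - w)) ` ?W)"
  have nz: "f \<noteq> 0" "pderiv f \<noteq> 0"
    using deg by (auto simp: pderiv_eq_0_iff)
  obtain B where B: "pderiv f = Polynomial.smult (lead_coeff (pderiv f)) (\<Prod>w\<in>#B. [:-w, 1:])"
    using alg_closed_imp_factorization[OF nz(2)] by blast
  have W: "?W = set_mset B"
    using nz(2) by (subst B) (auto simp: poly_prod_mset)
  have eval: "v (poly (pderiv f) z) = (\<Prod>w\<in>#B. v (z - w))" for z
    using lead
    by (subst B) (simp add: v_mult v_prod_mset poly_prod_mset image_mset.compositionality o_def)
  have df: "integral_poly (pderiv f)"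
    using f by (intro integral_poly_pderiv) (simp add: integral_poly_def)
  have fin: "finite ?Z" "finite ?W" using nz by (simp_all add: poly_roots_finite)
  \<comment> \<open>The derivative has positive degree, because \<open>degree f\<close> is at least
    2 and the characteristic is 0. Thus \<open>Max\<close> and \<open>Min\<close> range over finite
    nonempty sets.\<close>
  have ne: "?Z \<noteq> {}" "?W \<noteq> {}"
    using alg_closed_imp_poly_has_root[of f]
      alg_closed_imp_poly_has_root[of "pderiv f"] deg by (auto simp: degree_pderiv)
  \<comment> \<open>The critical points also lie in the unit disk, because the derivative is
    integral with leading coefficient of value 1.\<close>
  have dist: "v (z - w) \<le> 1" if "z \<in> ?Z" "w \<in> ?W" for z w
    using v_diff_le_max[of z w] roots[of z] v_root_le_1[OF df lead, of w] that by simp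
  have d_le: "?d z \<le> 1" if "z \<in> ?Z" for z
    using ne(2) fin(2) dist[OF that] by (auto simp: Min_le_iff)
  have d_eq: "?d z = 1 \<longleftrightarrow> v (poly (pderiv f) z) = 1" if z: "z \<in> ?Z" for z
  proof
    assume "?d z = 1"
    then have "1 \<le> v (z - w)" if "w \<in># B" for w
      using that fin(2) W Min_le[of "(\<lambda>w. v (z - w)) ` ?W" "v (z - w)"] by force
    then have "1 \<le> v (poly (pderiv f) z)"
      unfolding eval by (intro one_le_prod_mset) auto
    then show "v (poly (pderiv f) z) = 1"
      using v_poly_le_1[OF df, of z] roots z by force
  next
    assume 1: "v (poly (pderiv f) z) = 1"
    have "v (z - w) = 1" if "w \<in> ?W" for w
      by (rule prod_mset_eq_1_imp_eq_1[of "image_mset (\<lambda>w. v (z - w)) B"])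
        (use 1 that dist[OF z] W v_nonneg in \<open>auto simp: eval\<close>)
    then have "(\<lambda>w. v (z - w)) ` ?W = {1}" using ne(2) by force
    then show "?d z = 1" by simp
  qed
  \<comment> \<open>No minimum exceeds 1, so the maximum is 1 exactly when some zero attains
    it.\<close>
  have "critical_distance v f = 1 \<longleftrightarrow> (\<exists>z\<in>?Z. ?d z = 1)"
    unfolding critical_distance_def
    using fin(1) ne(1) d_le by (subst Max_eq_iff) (auto intro: rev_image_eqI)
  then show ?thesis using d_eq by auto
qed

theorem theorem3:
  fixes v :: "'a::{alg_closed_field, field_char_0} \<Rightarrow> real"
    and f :: "'a poly"
    and n :: nat
  assumes "nonarch_absolute_value v"
    and "n \<ge> 2"
    and "Polynomial.degree f = n"
    and "Polynomial.lead_coeff f = 1"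
    and "\<And>z. poly f z = 0 \<Longrightarrow> v z \<le> 1"
    and "v (of_nat n) = 1"
  shows "critical_distance v f = 1 \<longleftrightarrow>
    \<not> reduction v f divides\<^bsub>UP (residue_field v)\<^esub>
        (reduction v (pderiv f) [^]\<^bsub>UP (residue_field v)\<^esub> n)"
proof -
  interpret nonarch_absolute_value v by fact
  have "f \<noteq> 0" using assms(4) by auto
  \<comment> \<open>\<open>A\<close> lists the zeros with multiplicity, so its size is the exponent
    \<open>n\<close> of the theorem.\<close>
  then obtain A where A: "size A = n" "f = (\<Prod>z\<in>#A. [:-z, 1:])"
    using alg_closed_imp_factorization[of f] assms(3,4) by auto
  have Z: "poly f z = 0 \<longleftrightarrow> z \<in># A" for z
    by (auto simp: A(2) poly_prod_mset)
  have f: "integral_poly f"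
    unfolding A(2) using assms(5) Z by (intro integral_poly_prod_mset) (auto simp: v_1 v_uminus)
  \<comment> \<open>Here \<open>v (of_nat n) = 1\<close> enters: it gives the leading coefficient of
    the derivative value 1.\<close>
  have "lead_coeff (pderiv f) = of_nat n"
    using assms(2-4) by (simp add: degree_pderiv coeff_pderiv)
  then have "critical_distance v f = 1 \<longleftrightarrow> (\<exists>z. poly f z = 0 \<and> v (poly (pderiv f) z) = 1)"
    using assms f by (intro critical_distance_eq_1_iff) (auto simp: integral_poly_def)
  \<comment> \<open>The derivative is integral and the zeros lie in the unit disk, so its values
    there are at most 1; not being below 1 means being equal to 1.\<close>
  also have "\<dots> \<longleftrightarrow> \<not> (\<forall>z\<in>#A. v (poly (pderiv f) z) < 1)"
    using v_poly_le_1[OF integral_poly_pderiv[OF f]] assms(5) Z by (metis less_irrefl order_less_le)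
  also have "(\<forall>z\<in>#A. v (poly (pderiv f) z) < 1) \<longleftrightarrow>
      reduction v f divides\<^bsub>UP (residue_field v)\<^esub>
        (reduction v (pderiv f) [^]\<^bsub>UP (residue_field v)\<^esub> n)"
    using reduction_divides_power_iff[OF integral_poly_pderiv[OF f], of A] assms(5) Z A by simp
  finally show ?thesis .
qed

end
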